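(* Let $E\subset\mathbb{C}$ be a regular compact set and $(a_n)_{n=0}^\infty$ a pseudo Leja sequence in $E$ of Edrei growth $(C_n)_{n=1}^\infty$. Then for every $n$ and every $j\in\{1,2,\dots,n-1\}$, $$|a_j-a_n|\ge\frac{1}{2e\,C_n}\max\{\varrho_n(a_j),\varrho_n(a_n)\},$$ where $\varrho_n(z):=\mathrm{dist}\big(z,\{w\in\mathbb{C}:g_E(w)=\log(1+1/n)\}\big)$.
   Context: For compact $E\subset\mathbb{C}$, $\widehat E=\{z\in\mathbb{C}:|p(z)|\le\max_{w\in E}|p(w)|\text{ for every complex polynomial }p\}$. $E$ is regular if the Green function of $D_\infty=\mathbb{C}\setminus\widehat E$ with pole at infinity exists: a function $g_E$, harmonic and positive in $D_\infty$, with $g_E(z)\to0$ as $z\to\partial D_\infty$ and $g_E(z)-\log|z|$ tending to a finite number as $z\to\infty$. It is extended by $0$ on $\widehat E$ to a continuous function on $\mathbb{C}$. $\|\cdot\|_E$ is the sup norm on $E$. Pseudo Leja sequence: let $(C_n)_{n=1}^\infty$ be real numbers with $\lim_{n\to\infty}C_n^{1/n}=1$. A sequence of points $a_n\in E$, $n=0,1,2,\dots$, is a pseudo Leja sequence in $E$ of Edrei growth $(C_n)$ if $C_n|w_n(a_n)|\ge\|w_n\|_E$ for all $n\ge1$, where $w_n(z)=(z-a_0)\cdots(z-a_{n-1})$. *)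

theory Defs
  imports "HOL-Complex_Analysis.Complex_Analysis"
begin

text \<open>
  For compact nonempty \<open>E\<close> and continuous \<open>f\<close> the supremum is attained, so it is the
  maximum of \<open>|f|\<close> on \<open>E\<close>. It is unspecified for \<open>E = {}\<close>.
\<close>

definition sup_norm :: "complex set \<Rightarrow> (complex \<Rightarrow> complex) \<Rightarrow> real" where
  "sup_norm E f = (SUP w\<in>E. cmod (f w))"

definition poly_hull :: "complex set \<Rightarrow> complex set" where
  "poly_hull E = {z. \<forall>p :: complex poly. cmod (poly p z) \<le> sup_norm E (poly p)}"

abbreviation outer_domain :: "complex set \<Rightarrow> complex set" where
  "outer_domain E \<equiv> - poly_hull E"

text \<open>
  Real-valued \<open>C\<^sup>2\<close> solutions of the Laplace equation on an open subset of the plane: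
  \<open>ux\<close>, \<open>uy\<close> are the first and \<open>uxx\<close>, \<open>uxy\<close>, \<open>uyx\<close>, \<open>uyy\<close> the second partial derivatives
  of \<open>u\<close>, with \<open>uxy\<close> the \<open>y\<close>-derivative of \<open>ux\<close> and \<open>uyx\<close> the \<open>x\<close>-derivative of \<open>uy\<close>.
\<close>

definition harmonic_on :: "(complex \<Rightarrow> real) \<Rightarrow> complex set \<Rightarrow> bool" where
  "harmonic_on u D \<longleftrightarrow> open D \<and>
     (\<exists>ux uy uxx uxy uyx uyy.
        (\<forall>z\<in>D. (u has_derivative (\<lambda>h. ux z * Re h + uy z * Im h)) (at z)) \<and>
        (\<forall>z\<in>D. (ux has_derivative (\<lambda>h. uxx z * Re h + uxy z * Im h)) (at z)) \<and>
        (\<forall>z\<in>D. (uy has_derivative (\<lambda>h. uyx z * Re h + uyy z * Im h)) (at z)) \<and>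
        continuous_on D uxx \<and> continuous_on D uxy \<and>
        continuous_on D uyx \<and> continuous_on D uyy \<and>
        (\<forall>z\<in>D. uxx z + uyy z = 0))"

text \<open>
  \<open>g\<close> is the Green function of the outer domain of \<open>E\<close> with pole at infinity, extended by 0 to
  the whole plane. By the maximum principle there is at most one such \<open>g\<close> for each compact
  nonempty \<open>E\<close>, so a statement about all such \<open>g\<close> is a statement about \<^emph>\<open>the\<close> Green function.
\<close>

definition is_green_function :: "complex set \<Rightarrow> (complex \<Rightarrow> real) \<Rightarrow> bool" where
  "is_green_function E g \<longleftrightarrow>
     harmonic_on g (outer_domain E) \<and>
     (\<forall>z\<in>outer_domain E. g z > 0) \<and>
     (\<forall>\<zeta>\<in>frontier (outer_domain E). (g \<longlongrightarrow> 0) (at \<zeta> within outer_domain E)) \<and>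
     (\<exists>c. ((\<lambda>z. g z - ln (cmod z)) \<longlongrightarrow> c) at_infinity) \<and>
     (\<forall>z\<in>poly_hull E. g z = 0)"

definition regular_compact :: "complex set \<Rightarrow> bool" where
  "regular_compact E \<longleftrightarrow> compact E \<and> (\<exists>g. is_green_function E g)"

definition leja_poly :: "(nat \<Rightarrow> complex) \<Rightarrow> nat \<Rightarrow> complex \<Rightarrow> complex" where
  "leja_poly a n z = (\<Prod>k<n. z - a k)"

text \<open>The value \<open>C 0\<close> is irrelevant: the growth sequence is indexed from 1.\<close>

definition pseudo_leja :: "complex set \<Rightarrow> (nat \<Rightarrow> real) \<Rightarrow> (nat \<Rightarrow> complex) \<Rightarrow> bool" where
  "pseudo_leja E C a \<longleftrightarrow>
     (\<lambda>n. root n (C n)) \<longlonglongrightarrow> 1 \<and>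
     (\<forall>n. a n \<in> E) \<and>
     (\<forall>n\<ge>1. C n * cmod (leja_poly a n (a n)) \<ge> sup_norm E (leja_poly a n))"

definition level_dist :: "(complex \<Rightarrow> real) \<Rightarrow> nat \<Rightarrow> complex \<Rightarrow> real" where
  "level_dist g n z = infdist z {w. g w = ln (1 + 1 / real n)}"

end

theory Submission
  imports Defs
begin

text \<open>
  Let \<open>w = leja_poly a n\<close> and \<open>M = sup_norm E w\<close>. The Bernstein-Walsh inequality
  \<open>\<bar>w\<bar> \<le> M e\<^bsup>n g\<^esup>\<close> (\<open>bernstein_walsh\<close>) shows that \<open>\<bar>w\<bar> \<le> M (1 + 1/n)\<^sup>n \<le> e M\<close> wherever
  \<open>g \<le> ln (1 + 1/n)\<close>. Let \<open>c\<close> be one of \<open>a j\<close>, \<open>a n\<close> and \<open>b\<close> the other. Since \<open>g\<close> is continuous and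
  vanishes at \<open>c\<close>, it stays below \<open>ln (1 + 1/n)\<close> on the disc about \<open>c\<close> that reaches up to the level
  line. If \<open>b\<close> is less than half as far from \<open>c\<close> as the level line, then Cauchy's estimate on discs
  of half that radius bounds \<open>w'\<close> on the segment from \<open>c\<close> to \<open>b\<close>, hence bounds \<open>\<bar>w c - w b\<bar>\<close> by
  a multiple of \<open>\<bar>c - b\<bar>\<close> (\<open>level_dist_times_difference_le\<close>). But \<open>w (a j) = 0\<close>, and
  \<open>\<bar>w (a n)\<bar> \<ge> M / C n\<close> by the pseudo Leja property, so the two points cannot be close. If \<open>b\<close> is
  farther away, the claim only needs \<open>C n \<ge> 1\<close>, which follows from \<open>M > 0\<close>. The positivity of \<open>M\<close>
  says that a set with a Green function does not lie in the zero set of a nonzero polynomial,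
  and is again Bernstein-Walsh (\<open>sup_norm_pos\<close>).

  For Bernstein-Walsh, the function \<open>\<bar>p\<bar> e\<^bsup>- s g\<^esup>\<close> with \<open>s > n \<ge> degree p\<close> is continuous on the
  plane, tends to 0 at infinity, and is at most \<open>sup_norm E p\<close> on the hull of \<open>E\<close>. Off the hull
  it is locally the modulus of a holomorphic function, because a harmonic function is locally a
  real part (\<open>harmonic_on_local_Re\<close>). If it exceeded \<open>sup_norm E p\<close> somewhere, it would attain its
  maximum only off the hull, and by the maximum modulus principle on an open set. That set is also
  closed and bounded, which is impossible in the plane. Finally \<open>s\<close> tends to \<open>n\<close>.
\<close>

section \<open>Harmonic functions as local real parts\<close>

text \<open>
  The left side of the identity is symmetric in the two coordinates, while the right side singles
  out one order of differentiation. Applying this to both orders and letting \<open>h\<close> tend to 0 compares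
  the mixed partial derivatives.
\<close>

lemma second_difference_mvt:
  fixes F Fx Fxy :: "real \<Rightarrow> real \<Rightarrow> real"
  assumes h: "0 < h" "h < r"
    and Fx: "\<And>x y. \<lbrakk>\<bar>x\<bar> < r; \<bar>y\<bar> < r\<rbrakk> \<Longrightarrow> ((\<lambda>x. F x y) has_real_derivative Fx x y) (at x)"
    and Fxy: "\<And>x y. \<lbrakk>\<bar>x\<bar> < r; \<bar>y\<bar> < r\<rbrakk> \<Longrightarrow> ((\<lambda>y. Fx x y) has_real_derivative Fxy x y) (at y)"
  obtains x y where "0 < x" "x < h" "0 < y" "y < h"
    "F h h - F h 0 - F 0 h + F 0 0 = h\<^sup>2 * Fxy x y"
proof -
  have "\<exists>x. 0 < x \<and> x < h \<and> (F h h - F h 0) - (F 0 h - F 0 0) = (h - 0) * (Fx x h - Fx x 0)"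
    by (rule MVT2) (use h in \<open>auto intro!: derivative_eq_intros Fx\<close>)
  then obtain x where x: "0 < x" "x < h"
    and eq1: "(F h h - F h 0) - (F 0 h - F 0 0) = (h - 0) * (Fx x h - Fx x 0)"
    by blast
  have "\<exists>y. 0 < y \<and> y < h \<and> Fx x h - Fx x 0 = (h - 0) * Fxy x y"
    by (rule MVT2) (use h x in \<open>auto intro!: Fxy\<close>)
  then obtain y where y: "0 < y" "y < h" and eq2: "Fx x h - Fx x 0 = (h - 0) * Fxy x y"
    by blast
  have "F h h - F h 0 - F 0 h + F 0 0 = h\<^sup>2 * Fxy x y"
    using eq1 unfolding eq2 by (simp add: power2_eq_square algebra_simps)
  with x y show ?thesis by (rule that)
qed

lemma mixed_partials_commute:
  fixes u ux uy uxx uxy uyx uyy :: "complex \<Rightarrow> real"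
  assumes "open D" "z \<in> D"
    and u: "\<And>z. z \<in> D \<Longrightarrow> (u has_derivative (\<lambda>h. ux z * Re h + uy z * Im h)) (at z)"
    and ux: "\<And>z. z \<in> D \<Longrightarrow> (ux has_derivative (\<lambda>h. uxx z * Re h + uxy z * Im h)) (at z)"
    and uy: "\<And>z. z \<in> D \<Longrightarrow> (uy has_derivative (\<lambda>h. uyx z * Re h + uyy z * Im h)) (at z)"
    and cont: "continuous_on D uxy" "continuous_on D uyx"
  shows "uxy z = uyx z"
proof (rule ccontr)
  assume ne: "uxy z \<noteq> uyx z"
  define e where "e = \<bar>uxy z - uyx z\<bar> / 2"
  have "e > 0" using ne by (simp add: e_def)
  have iso: "isCont uxy z" "isCont uyx z"
    using cont assms(1,2) by (simp_all add: continuous_on_eq_continuous_at)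
  obtain d1 where d1: "d1 > 0" "\<And>w. dist w z < d1 \<Longrightarrow> dist (uxy w) (uxy z) < e"
    using iso(1) \<open>e > 0\<close> unfolding continuous_at_eps_delta by blast
  obtain d2 where d2: "d2 > 0" "\<And>w. dist w z < d2 \<Longrightarrow> dist (uyx w) (uyx z) < e"
    using iso(2) \<open>e > 0\<close> unfolding continuous_at_eps_delta by blast
  obtain d3 where d3: "d3 > 0" "ball z d3 \<subseteq> D"
    using assms(1,2) openE by blast
  define r where "r = min (min d1 d2) d3 / 2"
  have r: "r > 0" using d1 d2 d3 by (simp add: r_def)
  have near: "dist (z + Complex x y) z < min (min d1 d2) d3" if "\<bar>x\<bar> < r" "\<bar>y\<bar> < r" for x y
    using cmod_le[of "Complex x y"] that by (simp add: dist_norm r_def)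
  have inD: "z + Complex x y \<in> D" if "\<bar>x\<bar> < r" "\<bar>y\<bar> < r" for x y
    using near[OF that] d3(2) by (auto simp: dist_commute)
  \<comment> \<open>Differentiating along a line turns the Frechet derivative into a partial derivative.\<close>
  have dx: "((\<lambda>t. f (z + Complex t y)) has_real_derivative A) (at x)"
    if "(f has_derivative (\<lambda>h. A * Re h + B * Im h)) (at (z + Complex x y))"
    for f A B x y
  proof -
    have "((\<lambda>t. z + Complex t y) has_derivative (\<lambda>t. complex_of_real t)) (at x)"
      unfolding Complex_eq by (auto intro!: derivative_eq_intros)
    from has_derivative_compose[OF this that] show ?thesis
      by (simp add: has_field_derivative_def mult_commute_abs)
  qed
  have dy: "((\<lambda>t. f (z + Complex x t)) has_real_derivative B) (at y)"
    if "(f has_derivative (\<lambda>h. A * Re h + B * Im h)) (at (z + Complex x y))"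
    for f A B x y
  proof -
    have "((\<lambda>t. z + Complex x t) has_derivative (\<lambda>t. \<i> * complex_of_real t)) (at y)"
      unfolding Complex_eq by (auto intro!: derivative_eq_intros)
    from has_derivative_compose[OF this that] show ?thesis
      by (simp add: has_field_derivative_def mult_commute_abs)
  qed
  define h where "h = r / 2"
  have h: "0 < h" "h < r" using r by (simp_all add: h_def)
  define \<Delta> where "\<Delta> = u (z + Complex h h) - u (z + Complex h 0) - u (z + Complex 0 h) + u (z + Complex 0 0)"
  obtain x1 y1 where 1: "0 < x1" "x1 < h" "0 < y1" "y1 < h"
    "\<Delta> = h\<^sup>2 * uxy (z + Complex x1 y1)"
    unfolding \<Delta>_def
  proof (rule second_difference_mvt[OF h])
    show "((\<lambda>x. u (z + Complex x y)) has_real_derivative ux (z + Complex x y)) (at x)"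
      if "\<bar>x\<bar> < r" "\<bar>y\<bar> < r" for x y
      by (rule dx[OF u[OF inD[OF that]]])
    show "((\<lambda>y. ux (z + Complex x y)) has_real_derivative uxy (z + Complex x y)) (at y)"
      if "\<bar>x\<bar> < r" "\<bar>y\<bar> < r" for x y
      by (rule dy[OF ux[OF inD[OF that]]])
  qed
  obtain y2 x2 where 2: "0 < y2" "y2 < h" "0 < x2" "x2 < h"
    "u (z + Complex h h) - u (z + Complex 0 h) - u (z + Complex h 0) + u (z + Complex 0 0)
      = h\<^sup>2 * uyx (z + Complex x2 y2)"
  proof (rule second_difference_mvt[OF h])
    show "((\<lambda>y. u (z + Complex x y)) has_real_derivative uy (z + Complex x y)) (at y)"
      if "\<bar>y\<bar> < r" "\<bar>x\<bar> < r" for x y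
      by (rule dy[OF u[OF inD[OF that(2,1)]]])
    show "((\<lambda>x. uy (z + Complex x y)) has_real_derivative uyx (z + Complex x y)) (at x)"
      if "\<bar>y\<bar> < r" "\<bar>x\<bar> < r" for x y
      by (rule dx[OF uy[OF inD[OF that(2,1)]]])
  qed
  have "h\<^sup>2 * uxy (z + Complex x1 y1) = h\<^sup>2 * uyx (z + Complex x2 y2)"
    using 1(5) 2(5) unfolding \<Delta>_def by linarith
  then have "uxy (z + Complex x1 y1) = uyx (z + Complex x2 y2)"
    using h by simp
  moreover have "dist (uxy (z + Complex x1 y1)) (uxy z) < e"
    using near[of x1 y1] 1 h by (intro d1) auto
  moreover have "dist (uyx (z + Complex x2 y2)) (uyx z) < e"
    using near[of x2 y2] 2 h by (intro d2) auto
  ultimately show False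
    by (auto simp: dist_real_def e_def abs_if split: if_splits)
qed

text \<open>
  By the Laplace equation and the symmetry of the mixed partial derivatives, \<open>u\<^sub>x - \<i> u\<^sub>y\<close> satisfies
  the Cauchy-Riemann equations. The real part of a primitive of it on a disc has the same gradient
  as \<open>u\<close>, so it differs from \<open>u\<close> by a constant.
\<close>

lemma harmonic_on_local_Re:
  assumes "harmonic_on u D" "z \<in> D"
  obtains r G where "r > 0" "ball z r \<subseteq> D" "G holomorphic_on ball z r"
    "\<And>w. w \<in> ball z r \<Longrightarrow> Re (G w) = u w"
proof -
  from assms(1) obtain ux uy uxx uxy uyx uyy where "open D"
    and u: "\<And>z. z \<in> D \<Longrightarrow> (u has_derivative (\<lambda>h. ux z * Re h + uy z * Im h)) (at z)"
    and ux: "\<And>z. z \<in> D \<Longrightarrow> (ux has_derivative (\<lambda>h. uxx z * Re h + uxy z * Im h)) (at z)"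
    and uy: "\<And>z. z \<in> D \<Longrightarrow> (uy has_derivative (\<lambda>h. uyx z * Re h + uyy z * Im h)) (at z)"
    and cont: "continuous_on D uxy" "continuous_on D uyx"
    and lap: "\<And>z. z \<in> D \<Longrightarrow> uxx z + uyy z = 0"
    unfolding harmonic_on_def by blast
  define f where "f w = Complex (ux w) (- uy w)" for w
  have f: "(f has_field_derivative Complex (uxx w) (- uyx w)) (at w)" if w: "w \<in> D" for w
  proof -
    have sym: "uxy w = uyx w"
      using mixed_partials_commute[OF \<open>open D\<close> w u ux uy cont] by blast
    have "uyy w = - uxx w" using lap[OF w] by simp
    then have eq: "(\<lambda>h. complex_of_real (uxx w * Re h + uxy w * Im h)
         - \<i> * complex_of_real (uyx w * Re h + uyy w * Im h)) = (*) (Complex (uxx w) (- uyx w))"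
      using sym by (auto simp: complex_eq_iff algebra_simps)
    have "f = (\<lambda>w. complex_of_real (ux w) - \<i> * complex_of_real (uy w))"
      by (auto simp: f_def complex_eq_iff)
    moreover have "((\<lambda>w. complex_of_real (ux w) - \<i> * complex_of_real (uy w)) has_derivative
       (\<lambda>h. complex_of_real (uxx w * Re h + uxy w * Im h)
         - \<i> * complex_of_real (uyx w * Re h + uyy w * Im h))) (at w)"
      by (intro has_derivative_diff has_derivative_mult_right has_derivative_of_real ux uy w)
    ultimately show ?thesis
      unfolding has_field_derivative_def eq by simp
  qed
  obtain r where r: "r > 0" "ball z r \<subseteq> D"
    using \<open>open D\<close> assms(2) openE by blast
  have "f holomorphic_on ball z r"
    using f r(2) by (meson DERIV_subset holomorphic_onI field_differentiable_def
        field_differentiable_at_within subsetD)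
  then obtain G where G: "\<And>x. x \<in> ball z r \<Longrightarrow> (G has_field_derivative f x) (at x within ball z r)"
    using holomorphic_convex_primitive'[OF convex_ball open_ball] by blast
  have "((\<lambda>w. Re (G w) - u w) has_derivative (\<lambda>h. 0)) (at w within ball z r)"
    if w: "w \<in> ball z r" for w
  proof -
    have "(u has_derivative (\<lambda>h. ux w * Re h + uy w * Im h)) (at w within ball z r)"
      using u w r(2) by (blast intro: has_derivative_at_withinI)
    then have "((\<lambda>w. Re (G w) - u w) has_derivative
        (\<lambda>h. Re (f w * h) - (ux w * Re h + uy w * Im h))) (at w within ball z r)"
      using G[OF w] unfolding has_field_derivative_def
      by (intro has_derivative_diff has_derivative_Re)
    then show ?thesis by (simp add: f_def)
  qed
  then have "\<exists>c. \<forall>w\<in>ball z r. Re (G w) - u w = c"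
    by (rule has_derivative_zero_constant[OF convex_ball])
  then obtain c where c: "\<And>w. w \<in> ball z r \<Longrightarrow> Re (G w) - u w = c"
    by blast
  have "G holomorphic_on ball z r"
    using G unfolding holomorphic_on_def field_differentiable_def by blast
  then have "(\<lambda>w. G w - of_real c) holomorphic_on ball z r"
    by (rule holomorphic_on_diff[OF _ holomorphic_on_const])
  moreover have "Re (G w - of_real c) = u w" if "w \<in> ball z r" for w
    using c[OF that] by simp
  ultimately show ?thesis using r that by blast
qed

text \<open>
  With \<open>g = Re G\<close> near \<open>z\<close>, the weighted modulus is the modulus of the holomorphic function
  \<open>f e\<^bsup>- s G\<^esup>\<close>, so the maximum modulus principle applies to it.
\<close>

lemma weighted_modulus_local_max:
  assumes "harmonic_on g D" "f holomorphic_on D" "z \<in> D"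
    and max: "\<And>w. w \<in> D \<Longrightarrow> cmod (f w) * exp (- s * g w) \<le> cmod (f z) * exp (- s * g z)"
  obtains r where "r > 0"
    "\<And>w. w \<in> ball z r \<Longrightarrow> cmod (f w) * exp (- s * g w) = cmod (f z) * exp (- s * g z)"
proof -
  obtain r G where r: "r > 0" "ball z r \<subseteq> D" and G: "G holomorphic_on ball z r"
    "\<And>w. w \<in> ball z r \<Longrightarrow> Re (G w) = g w"
    using harmonic_on_local_Re[OF assms(1,3)] by blast
  define F where "F w = f w * exp (- of_real s * G w)" for w
  have F: "cmod (F w) = cmod (f w) * exp (- s * g w)" if "w \<in> ball z r" for w
    using G(2)[OF that] by (simp add: F_def norm_mult)
  have "F holomorphic_on ball z r"
    unfolding F_def using holomorphic_on_subset[OF assms(2) r(2)] G(1)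
    by (intro holomorphic_intros)
  moreover have "cmod (F w) \<le> cmod (F z)" if "w \<in> ball z r" for w
    using max[of w] F[OF that] F[of z] r that by auto
  ultimately have "F constant_on ball z r"
    using r by (intro maximum_modulus_principle[of F "ball z r" "ball z r" z]) auto
  then have const: "F w = F z" if "w \<in> ball z r" for w
    using that r unfolding constant_on_def by (metis centre_in_ball)
  show ?thesis
  proof (rule that[OF r(1)])
    fix w assume w: "w \<in> ball z r"
    have "z \<in> ball z r" using r(1) by simp
    then show "cmod (f w) * exp (- s * g w) = cmod (f z) * exp (- s * g z)"
      using F[OF w] F[of z] const[OF w] by simp
  qed
qed

section \<open>The Bernstein-Walsh inequality\<close>

lemma poly_le_sup_norm:
  assumes "compact E" "z \<in> E"
  shows "cmod (poly p z) \<le> sup_norm E (poly p)"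
proof -
  have "compact ((\<lambda>w. cmod (poly p w)) ` E)"
    by (rule compact_continuous_image[OF continuous_on_norm[OF
        continuous_on_poly[OF continuous_on_id]] assms(1)])
  then show ?thesis
    unfolding sup_norm_def
    by (intro cSUP_upper[OF assms(2)] bounded_imp_bdd_above compact_imp_bounded)
qed

lemma sup_norm_poly_nonneg:
  assumes "compact E" "E \<noteq> {}"
  shows "sup_norm E (poly p) \<ge> 0"
proof -
  obtain z where "z \<in> E" using assms(2) by blast
  then have "cmod (poly p z) \<le> sup_norm E (poly p)"
    by (rule poly_le_sup_norm[OF assms(1)])
  then show ?thesis by (rule order_trans[OF norm_ge_zero])
qed

text \<open>
  The defining limit at boundary points is taken from the outer domain only. At such a point it
  has to be combined with the value 0 on the hull, which accounts for the other directions.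
\<close>

lemma isCont_green_function:
  assumes "is_green_function E g"
  shows "isCont g z"
proof (cases "z \<in> poly_hull E")
  case False
  with assms show ?thesis
    unfolding is_green_function_def harmonic_on_def
    by (metis Compl_iff has_derivative_continuous)
next
  case True
  have zero: "g w = 0" if "w \<in> poly_hull E" for w
    using assms that by (simp add: is_green_function_def)
  have "(g \<longlongrightarrow> 0) (at z within poly_hull E)"
    by (rule tendsto_eventually) (auto simp: eventually_at_filter zero)
  moreover have "(g \<longlongrightarrow> 0) (at z within - poly_hull E)"
  proof (cases "z \<in> frontier (- poly_hull E)")
    case True
    then show ?thesis using assms by (simp add: is_green_function_def)
  next
    case False
    with True have "at z within - poly_hull E = bot"
      using interior_subset[of "- poly_hull E"]
      by (auto simp: frontier_def closure_def trivial_limit_within)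
    then show ?thesis by simp
  qed
  ultimately have "(g \<longlongrightarrow> 0) (at z within (poly_hull E \<union> - poly_hull E))"
    by (rule Lim_Un)
  then show ?thesis
    using zero[OF True] by (simp add: isCont_def)
qed

lemma poly_growth:
  fixes p :: "complex poly"
  assumes "degree p \<le> n"
  obtains K where "K \<ge> 0" "\<And>z. cmod z \<ge> 1 \<Longrightarrow> cmod (poly p z) \<le> K * cmod z ^ n"
proof
  show "(\<Sum>i\<le>degree p. cmod (coeff p i)) \<ge> 0" by (simp add: sum_nonneg)
  fix z :: complex assume z: "cmod z \<ge> 1"
  have "cmod (poly p z) \<le> (\<Sum>i\<le>degree p. cmod (coeff p i) * cmod z ^ i)"
    unfolding poly_altdef by (rule order_trans[OF norm_sum]) (simp add: norm_mult norm_power)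
  also have "\<dots> \<le> (\<Sum>i\<le>degree p. cmod (coeff p i) * cmod z ^ n)"
    using z assms by (intro sum_mono mult_left_mono power_increasing) auto
  finally show "cmod (poly p z) \<le> (\<Sum>i\<le>degree p. cmod (coeff p i)) * cmod z ^ n"
    by (simp add: sum_distrib_right)
qed

text \<open>
  Near infinity \<open>g\<close> is \<open>ln \<bar>z\<bar>\<close> up to a bounded term, so the product is at most a constant times
  \<open>\<bar>z\<bar>\<^bsup>n - s\<^esup>\<close>. The strict inequality \<open>n < s\<close> gives decay at infinity, where \<open>s = n\<close> would only give
  a finite limit; this is what confines the maximum to a bounded set below.
\<close>

lemma weighted_poly_vanishes_at_infinity:
  fixes p :: "complex poly"
  assumes "is_green_function E g" "degree p \<le> n" "real n < s"
  shows "((\<lambda>z. cmod (poly p z) * exp (- s * g z)) \<longlongrightarrow> 0) at_infinity"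
proof -
  obtain c where c: "((\<lambda>z. g z - ln (cmod z)) \<longlongrightarrow> c) at_infinity"
    using assms(1) by (auto simp: is_green_function_def)
  obtain K where K: "K \<ge> 0" "\<And>z. cmod z \<ge> 1 \<Longrightarrow> cmod (poly p z) \<le> K * cmod z ^ n"
    using poly_growth[OF assms(2)] by blast
  have ev1: "\<forall>\<^sub>F z in at_infinity. g z - ln (cmod z) > c - 1"
    using c by (rule order_tendstoD) simp
  have ev2: "\<forall>\<^sub>F z in at_infinity. cmod (z::complex) \<ge> 1"
    by (auto simp: eventually_at_infinity)
  have "\<forall>\<^sub>F z in at_infinity. cmod (poly p z) * exp (- s * g z)
      \<le> K * exp (- s * (c - 1)) * cmod z powr (real n - s)"
    using ev1 ev2
  proof eventually_elim
    case (elim z)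
    have "s * (ln (cmod z) + (c - 1)) \<le> s * g z"
      using elim assms(3) by (intro mult_left_mono) auto
    then have "exp (- s * g z) \<le> exp (- s * (c - 1)) * exp (- s * ln (cmod z))"
      by (simp add: exp_add[symmetric] algebra_simps)
    also have "exp (- s * ln (cmod z)) = cmod z powr (- s)"
      using elim by (auto simp: powr_def)
    finally have "cmod (poly p z) * exp (- s * g z)
        \<le> (K * cmod z ^ n) * (exp (- s * (c - 1)) * cmod z powr (- s))"
      using K elim by (intro mult_mono) auto
    also have "cmod z ^ n = cmod z powr real n"
      using elim by (subst powr_realpow) auto
    finally show ?case
      by (simp add: powr_add[symmetric] algebra_simps powr_diff powr_minus divide_inverse)
  qed
  moreover have "((\<lambda>z::complex. K * exp (- s * (c - 1)) * cmod z powr (real n - s)) \<longlongrightarrow> 0) at_infinity"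
    using assms(3)
    by (intro tendsto_mult_right_zero tendsto_neg_powr filterlim_norm_at_top) auto
  ultimately show ?thesis
    by (rule tendsto_sandwich[OF _ _ tendsto_const, rotated]) (simp add: always_eventually)
qed

text \<open>
  If the bound failed, the set \<open>S\<close> of maximum points would lie off the hull and be nonempty,
  bounded and both open and closed, against the connectedness of the plane.
\<close>

lemma weighted_poly_le:
  fixes p :: "complex poly"
  assumes "compact E" "E \<noteq> {}" "is_green_function E g" "degree p \<le> n" "real n < s"
  shows "cmod (poly p z) * exp (- s * g z) \<le> sup_norm E (poly p)"
proof (rule ccontr)
  define V where "V w = cmod (poly p w) * exp (- s * g w)" for w
  define m where "m = sup_norm E (poly p)"
  assume "\<not> ?thesis"
  then have z: "V z > m" by (simp add: V_def m_def)
  have "m \<ge> 0"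
    unfolding m_def by (rule sup_norm_poly_nonneg[OF assms(1,2)])
  have cont: "continuous_on UNIV V"
    unfolding V_def continuous_on_eq_continuous_at[OF open_UNIV]
    by (intro ballI continuous_intros isCont_green_function[OF assms(3)])
  have "(V \<longlongrightarrow> 0) at_infinity"
    unfolding V_def by (rule weighted_poly_vanishes_at_infinity[OF assms(3-5)])
  then have "\<forall>\<^sub>F w in at_infinity. V w < V z"
    by (rule order_tendstoD(2)) (use z \<open>m \<ge> 0\<close> in simp)
  then obtain R where R: "\<And>w. cmod w \<ge> R \<Longrightarrow> V w < V z"
    unfolding eventually_at_infinity by blast
  have zR: "z \<in> cball 0 R" using R[of z] by (cases "R \<le> cmod z") auto
  obtain b where b: "b \<in> cball 0 R" "\<And>w. w \<in> cball 0 R \<Longrightarrow> V w \<le> V b"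
    using continuous_attains_sup[OF compact_cball _ continuous_on_subset[OF cont subset_UNIV],
        of 0 R] zR by blast
  have bmax: "V w \<le> V b" for w
    using b(2)[of w] b(2)[OF zR] R[of w] by (cases "cmod w \<le> R") auto
  define S where "S = {w. V w = V b}"
  have "S \<subseteq> cball 0 R"
  proof
    fix w assume "w \<in> S"
    then have "V z \<le> V w" using bmax[of z] by (simp add: S_def)
    then show "w \<in> cball 0 R" using R[of w] by (cases "R \<le> cmod w") auto
  qed
  then have "bounded S" using bounded_cball bounded_subset by blast
  have "closed S"
    unfolding S_def by (rule closed_Collect_eq[OF cont continuous_on_const])
  have out: "w \<notin> poly_hull E" if "w \<in> S" for w
  proof
    assume w: "w \<in> poly_hull E"
    then have "V w \<le> m"
      using assms(3) by (simp add: V_def m_def poly_hull_def is_green_function_def)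
    with that bmax[of z] z show False by (simp add: S_def)
  qed
  have "open S"
  proof (rule openI)
    fix w assume w: "w \<in> S"
    have "harmonic_on g (- poly_hull E)"
      using assms(3) by (simp add: is_green_function_def)
    moreover have "poly p holomorphic_on - poly_hull E"
      by (intro holomorphic_intros)
    moreover have "w \<in> - poly_hull E" using out[OF w] by simp
    moreover have "cmod (poly p v) * exp (- s * g v) \<le> cmod (poly p w) * exp (- s * g w)" for v
      using bmax[of v] w unfolding S_def V_def by simp
    ultimately obtain r where r: "r > 0" "\<And>v. v \<in> ball w r \<Longrightarrow> V v = V w"
      using weighted_modulus_local_max[of g "- poly_hull E" "poly p" w s] unfolding V_def by blast
    have "V v = V b" if "v \<in> ball w r" for v
      using r(2)[OF that] w by (simp only: S_def mem_Collect_eq)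
    then have "ball w r \<subseteq> S" unfolding S_def by blast
    with r(1) show "\<exists>r>0. ball w r \<subseteq> S" by blast
  qed
  moreover have "b \<in> S" by (simp add: S_def)
  ultimately have "S = UNIV"
    using \<open>closed S\<close> clopen by blast
  with \<open>bounded S\<close> show False by simp
qed

theorem bernstein_walsh:
  fixes p :: "complex poly"
  assumes "compact E" "E \<noteq> {}" "is_green_function E g" "degree p \<le> n"
  shows "cmod (poly p z) \<le> sup_norm E (poly p) * exp (real n * g z)"
proof -
  have "((\<lambda>s. cmod (poly p z) * exp (- s * g z)) \<longlongrightarrow> cmod (poly p z) * exp (- real n * g z))
      (at_right (real n))"
    by (intro tendsto_intros)
  moreover have "\<forall>\<^sub>F s in at_right (real n). cmod (poly p z) * exp (- s * g z) \<le> sup_norm E (poly p)"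
    using weighted_poly_le[OF assms] by (auto simp: eventually_at_right_less eventually_at_filter)
  ultimately have "cmod (poly p z) * exp (- real n * g z) \<le> sup_norm E (poly p)"
    by (rule tendsto_upperbound) simp
  then show ?thesis
    by (simp add: exp_minus field_simps)
qed

section \<open>Separation of pseudo Leja points\<close>

lemma leja_poly_eq_poly:
  obtains p :: "complex poly" where "leja_poly a n = poly p" "degree p = n"
proof
  show "leja_poly a n = poly (\<Prod>k<n. [:- a k, 1:])"
    by (auto simp: leja_poly_def poly_prod)
  show "degree (\<Prod>k<n. [:- a k, 1:]) = n"
    by (subst degree_prod_eq_sum_degree) auto
qed

text \<open>
  Crossing the level \<open>l\<close> inside the ball would, by connectedness, produce a point of the level set
  closer to \<open>c\<close> than the level set is.
\<close>

lemma continuous_lt_before_level: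
  fixes g :: "'a::euclidean_space \<Rightarrow> real"
  assumes "\<And>z. isCont g z" "g c < l" "w \<in> ball c (infdist c {w. g w = l})"
  shows "g w < l"
proof (rule ccontr)
  let ?B = "ball c (infdist c {w. g w = l})"
  assume w: "\<not> g w < l"
  have "connected (g ` ?B)"
    using assms(1) by (intro connected_continuous_image continuous_at_imp_continuous_on) auto
  moreover have "c \<in> ?B"
    using assms(3) by (auto intro: le_less_trans[OF zero_le_dist])
  ultimately have "l \<in> g ` ?B"
    using assms(2,3) w by (meson connected_contains_Icc atLeastAtMost_iff imageI less_imp_le
        linorder_not_less subsetD)
  then obtain v where "g v = l" "dist c v < infdist c {w. g w = l}" by auto
  with infdist_le[of v "{w. g w = l}" c] show False by simp
qed

text \<open>
  Discs of radius \<open>r / 2\<close> about the points no farther from \<open>c\<close> than \<open>b\<close> stay inside the big disc,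
  so Cauchy's estimate bounds \<open>f'\<close> there by \<open>2 B / r\<close>, and the mean value inequality applies.
\<close>

lemma holomorphic_difference_bound:
  assumes "f holomorphic_on ball c r" "2 * dist c b < r"
    and bound: "\<And>w. w \<in> ball c r \<Longrightarrow> cmod (f w) \<le> B"
  shows "r * cmod (f c - f b) \<le> 2 * B * cmod (c - b)"
proof -
  define d where "d = dist c b"
  have r: "r > 0" using assms(2) zero_le_dist[of c b] by linarith
  have der: "cmod (deriv f w) \<le> 2 * B / r" if w: "w \<in> cball c d" for w
  proof -
    have sub: "cball w (r / 2) \<subseteq> ball c r"
    proof
      fix v assume "v \<in> cball w (r / 2)"
      then show "v \<in> ball c r"
        using w assms(2) dist_triangle[of c v w] by (simp add: d_def)
    qed
    have "cmod ((deriv ^^ 1) f w) \<le> fact 1 * B / (r / 2) ^ 1"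
    proof (rule Cauchy_inequality)
      show "f holomorphic_on ball w (r / 2)"
        using assms(1) order_trans[OF ball_subset_cball sub] by (rule holomorphic_on_subset)
      show "continuous_on (cball w (r / 2)) f"
        using holomorphic_on_imp_continuous_on[OF assms(1)] sub by (rule continuous_on_subset)
      show "cmod (f x) \<le> B" if "cmod (w - x) = r / 2" for x
        using sub that by (intro bound) (auto simp: dist_norm)
    qed (use r in auto)
    then show ?thesis by (simp add: mult.commute)
  qed
  have "cmod (f c - f b) \<le> 2 * B / r * cmod (c - b)"
  proof (rule field_differentiable_bound[OF convex_cball _ der])
    show "(f has_field_derivative deriv f w) (at w within cball c d)" if "w \<in> cball c d" for w
    proof -
      have "w \<in> ball c r"
        using that assms(2) zero_le_dist[of c b] unfolding d_def mem_ball mem_cball by linarith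
      then show ?thesis
        by (rule DERIV_subset[OF holomorphic_derivI[OF assms(1) open_ball] subset_UNIV])
    qed
  qed (auto simp: d_def)
  then show ?thesis using r by (simp add: field_simps)
qed

lemma level_dist_times_difference_le:
  fixes p :: "complex poly"
  assumes "compact E" "is_green_function E g" "degree p \<le> n" "n > 0" "c \<in> E"
    and "2 * dist c b < level_dist g n c"
  shows "level_dist g n c * cmod (poly p c - poly p b) \<le> 2 * exp 1 * sup_norm E (poly p) * cmod (c - b)"
proof -
  define M where "M = sup_norm E (poly p)"
  have "M \<ge> 0"
    unfolding M_def using assms(1,5) by (intro sup_norm_poly_nonneg) auto
  have "c \<in> poly_hull E"
    unfolding poly_hull_def using poly_le_sup_norm[OF assms(1,5)] by blast
  then have gc: "g c < ln (1 + 1 / real n)"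
    using assms(2,4) by (simp add: is_green_function_def ln_gt_zero)
  have "cmod (poly p w) \<le> exp 1 * M" if "w \<in> ball c (level_dist g n c)" for w
  proof -
    have "g w < ln (1 + 1 / real n)"
      using continuous_lt_before_level[OF isCont_green_function[OF assms(2)] gc] that
      by (simp add: level_dist_def)
    then have "exp (real n * g w) \<le> exp (real n * ln (1 + 1 / real n))"
      by (auto intro: mult_left_mono)
    also have "\<dots> = (1 + 1 / real n) ^ n"
      by (subst exp_of_nat_mult, subst exp_ln) (auto intro: add_pos_nonneg)
    also have "\<dots> \<le> exp 1"
      using exp_ge_one_plus_x_over_n_power_n[of n 1] assms(4) by simp
    finally have "exp (real n * g w) \<le> exp 1" .
    then have "M * exp (real n * g w) \<le> M * exp 1"
      using \<open>M \<ge> 0\<close> by (rule mult_left_mono)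
    moreover have "cmod (poly p w) \<le> M * exp (real n * g w)"
      unfolding M_def using assms by (intro bernstein_walsh) auto
    ultimately show ?thesis by (simp add: mult.commute)
  qed
  then have "level_dist g n c * cmod (poly p c - poly p b) \<le> 2 * (exp 1 * M) * cmod (c - b)"
    using assms(6)
    by (intro holomorphic_difference_bound) (auto intro!: holomorphic_intros)
  then show ?thesis by (simp add: M_def mult.assoc)
qed

text \<open>
  If \<open>p\<close> vanished on \<open>E\<close>, the Bernstein-Walsh inequality would make it vanish everywhere.
\<close>

lemma sup_norm_pos:
  fixes p :: "complex poly"
  assumes "compact E" "E \<noteq> {}" "is_green_function E g" "p \<noteq> 0"
  shows "sup_norm E (poly p) > 0"
proof -
  obtain z where z: "poly p z \<noteq> 0"
    using assms(4) poly_all_0_iff_0 by blast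
  have "0 < cmod (poly p z)" using z by simp
  also have "\<dots> \<le> sup_norm E (poly p) * exp (real (degree p) * g z)"
    using assms by (intro bernstein_walsh) auto
  finally show ?thesis by (simp add: zero_less_mult_iff)
qed

theorem proposition3p8:
  fixes E :: "complex set" and g :: "complex \<Rightarrow> real"
    and C :: "nat \<Rightarrow> real" and a :: "nat \<Rightarrow> complex" and n j :: nat
  assumes "regular_compact E"
    and "is_green_function E g"
    and "pseudo_leja E C a"
    and "1 \<le> j" and "j \<le> n - 1"
  shows "cmod (a j - a n) \<ge> 1 / (2 * exp 1 * C n) * max (level_dist g n (a j)) (level_dist g n (a n))"
proof -
  have n: "n > 0" "j < n" using assms(4,5) by auto
  have E: "compact E" using assms(1) by (simp add: regular_compact_def)
  have aE: "a k \<in> E" for k using assms(3) by (simp add: pseudo_leja_def)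
  then have ne: "E \<noteq> {}" by blast
  obtain p where p: "leja_poly a n = poly p" "degree p = n"
    by (rule leja_poly_eq_poly)
  define M where "M = sup_norm E (poly p)"
  have M: "M > 0"
    unfolding M_def using p(2) n by (intro sup_norm_pos[OF E ne assms(2)]) auto
  have edrei: "M \<le> C n * cmod (poly p (a n))"
    using assms(3) n unfolding pseudo_leja_def M_def p(1)[symmetric] by simp
  have le: "cmod (poly p (a n)) \<le> M"
    unfolding M_def by (rule poly_le_sup_norm[OF E aE])
  have "C n > 0"
    using M edrei by (smt (verit) mult_nonneg_nonneg mult_nonpos_nonneg norm_ge_zero)
  then have "C n * cmod (poly p (a n)) \<le> C n * M"
    using le by (intro mult_left_mono) auto
  then have "1 * M \<le> C n * M" using edrei by linarith
  then have C: "C n \<ge> 1" using M by (subst (asm) mult_le_cancel_right) auto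
  have zero: "poly p (a j) = 0"
    using n unfolding p(1)[symmetric] leja_poly_def by (intro prod_zero) auto
  \<comment> \<open>The estimate is symmetric in the two points: either may be the centre of the disc.\<close>
  have main: "level_dist g n c \<le> 2 * exp 1 * C n * cmod (c - b)"
    if cb: "(c = a j \<and> b = a n) \<or> (c = a n \<and> b = a j)" for c b
  proof (cases "2 * dist c b < level_dist g n c")
    case True
    have "c \<in> E" using cb aE by auto
    have L: "level_dist g n c \<ge> 0" by (simp add: level_dist_def infdist_nonneg)
    have diff: "cmod (poly p c - poly p b) = cmod (poly p (a n))"
      using cb zero by auto
    have "level_dist g n c * M \<le> level_dist g n c * (C n * cmod (poly p (a n)))"
      using edrei L by (rule mult_left_mono)
    also have "\<dots> = C n * (level_dist g n c * cmod (poly p c - poly p b))"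
      by (simp add: diff)
    also have "\<dots> \<le> C n * (2 * exp 1 * M * cmod (c - b))"
      unfolding M_def using C p(2) n True \<open>c \<in> E\<close>
      by (intro mult_left_mono level_dist_times_difference_le[OF E assms(2)]) auto
    finally have "level_dist g n c * M \<le> (2 * exp 1 * C n * cmod (c - b)) * M"
      by (simp add: mult_ac)
    then show ?thesis using M by simp
  next
    case False
    have "1 * 1 \<le> exp 1 * C n"
      using C by (intro mult_mono) auto
    then have "1 * (2 * cmod (c - b)) \<le> exp 1 * C n * (2 * cmod (c - b))"
      by (intro mult_right_mono) auto
    with False show ?thesis by (simp add: dist_norm mult_ac)
  qed
  have "max (level_dist g n (a j)) (level_dist g n (a n)) \<le> 2 * exp 1 * C n * cmod (a j - a n)"
    using main[of "a j" "a n"] main[of "a n" "a j"] by (simp add: norm_minus_commute)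
  then show ?thesis
    using C by (simp add: field_simps)
qed

end
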